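(* Let $F$ be an algebraically closed field, $Q$ a finite acyclic quiver, and $\mu=\Theta/\kappa$ a slope function for $Q$. Let $(\mathbf{d}^k)_{k\ge1}$ be an unbounded sequence of dimension vectors. Assume that for every $0<\delta<1$ there is a positive real number $\epsilon(\delta)$ such that $\epsilon^{\rm eff}_{\mathbf{d}^k}(\delta)\ge\epsilon(\delta)$ for all $k$. Then $(\mathbf{d}^k)_k$ supports a uniform expander (with respect to $\mu$).
   Context: All representations are finite-dimensional representations of $Q$ over $F$. Dimension vectors are vectors $\mathbf{d}=\sum_{i\in Q_0}d_i\mathbf{i}$ with nonnegative integer entries; $\mathbf{dim}(V)=\sum_i(\dim_FV_i)\mathbf{i}$ and $\dim V=\sum_i\dim_FV_i$. The relation $\mathbf{e}\le\mathbf{d}$ is componentwise. A sequence of dimension vectors is unbounded if for every $d$ there is an index $k$ with $\sum_i d^k_i\ge d$. The Euler form is $\langle\mathbf{d},\mathbf{e}\rangle=\sum_{i\in Q_0}d_ie_i-\sum_{\alpha:i\to j}d_ie_j$ (second sum over all arrows of $Q$). Slope function: $\Theta,\kappa\in(\mathbb{R}Q_0)^*$ are linear functionals with $\kappa(\mathbf{i})>0$ for all $i\in Q_0$, and $\mu(\mathbf{d})=\Theta(\mathbf{d})/\kappa(\mathbf{d})$ for $\mathbf{d}\in\mathbb{R}_{\ge0}Q_0\setminus\{0\}$; $\kappa(V),\mu(V)$ denote the values at $\mathbf{dim}(V)$. For a dimension vector $\mathbf{d}$ and $\delta\in(0,1)$ define $$\epsilon^{\rm eff}_{\mathbf{d}}(\delta)=\min\{\mu(\mathbf{d})-\mu(\mathbf{e})\,|\,0\ne\mathbf{e}\le\mathbf{d},\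 \langle\mathbf{e},\mathbf{d}-\mathbf{e}\rangle\ge0,\ \kappa(\mathbf{e})\le\delta\cdot\kappa(\mathbf{d})\},$$ where $\mathbf{e}$ ranges over dimension vectors (the minimum over the empty set is $+\infty$). For $0<\delta<1$, $\epsilon>0$, a representation $V$ is a $(\delta,\epsilon)$-expander (with respect to $\mu$) if for all nonzero subrepresentations $U\subset V$ with $\kappa(U)\le\delta\cdot\kappa(V)$ we have $\mu(U)<\mu(V)-\epsilon$. A family $(V^{(k)})_{k\ge1}$ is unbounded if for every $d$ some member has $\dim V^{(k)}\ge d$. An unbounded family is a uniform expander if for every $\delta\in(0,1)$ there is $\epsilon'(\delta)>0$ such that every $V^{(k)}$ is a $(\delta,\epsilon'(\delta))$-expander. The sequence $(\mathbf{d}^k)_k$ supports a uniform expander if there is a uniform expander $(V^{(k)})_k$ with $\mathbf{dim}(V^{(k)})=\mathbf{d}^k$ for all $k\ge1$. *)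

theory Defs
  imports
    "Graph_Theory.Arc_Walk"
    "Jordan_Normal_Form.VS_Connect"
    "HOL-Library.Extended_Real"
begin

text \<open>
  A quiver is a directed multigraph of type \<^typ>\<open>('v, 'a) pre_digraph\<close>, an arrow \<open>a\<close> going
  from \<open>tail Q a\<close> to \<open>head Q a\<close>. In \<open>acyclic_quiver\<close>, the library's \<^const>\<open>pre_digraph.cycle\<close>
  means directed cycle and includes loops; parallel arrows are allowed.
\<close>

definition acyclic_quiver :: "('v, 'a) pre_digraph \<Rightarrow> bool" where
  "acyclic_quiver Q \<longleftrightarrow> (\<nexists>p. pre_digraph.cycle Q p)"

text \<open>
  Dimension vectors are functions on the vertex type that vanish off the vertex set, so that
  equality and the order of functions are the componentwise ones on the vertices.
\<close>

definition dimension_vector :: "('v, 'a) pre_digraph \<Rightarrow> ('v \<Rightarrow> nat) \<Rightarrow> bool" where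
  "dimension_vector Q d \<longleftrightarrow> (\<forall>i. i \<notin> verts Q \<longrightarrow> d i = 0)"

definition total_dim :: "('v, 'a) pre_digraph \<Rightarrow> ('v \<Rightarrow> nat) \<Rightarrow> nat" where
  "total_dim Q d = (\<Sum>i\<in>verts Q. d i)"

definition unbounded_dims :: "('v, 'a) pre_digraph \<Rightarrow> (nat \<Rightarrow> 'v \<Rightarrow> nat) \<Rightarrow> bool" where
  "unbounded_dims Q d \<longleftrightarrow> (\<forall>n. \<exists>k\<ge>1. n \<le> total_dim Q (d k))"

definition euler_form ::
    "('v, 'a) pre_digraph \<Rightarrow> ('v \<Rightarrow> nat) \<Rightarrow> ('v \<Rightarrow> nat) \<Rightarrow> int" where
  "euler_form Q d e =
    (\<Sum>i\<in>verts Q. int (d i) * int (e i)) -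
    (\<Sum>a\<in>arcs Q. int (d (tail Q a)) * int (e (head Q a)))"

text \<open>
  A linear functional on the real space with basis \<open>verts Q\<close> is given by its values \<open>\<theta> i\<close> on the
  basis vectors.
\<close>

definition functional :: "('v, 'a) pre_digraph \<Rightarrow> ('v \<Rightarrow> real) \<Rightarrow> ('v \<Rightarrow> nat) \<Rightarrow> real" where
  "functional Q \<theta> d = (\<Sum>i\<in>verts Q. \<theta> i * real (d i))"

definition slope ::
    "('v, 'a) pre_digraph \<Rightarrow> ('v \<Rightarrow> real) \<Rightarrow> ('v \<Rightarrow> real) \<Rightarrow> ('v \<Rightarrow> nat) \<Rightarrow> real" where
  "slope Q \<theta> \<kappa> d = functional Q \<theta> d / functional Q \<kappa> d"

text \<open>
  The competitors \<open>e\<close> in the definition of the effective expansion constant. The natural-number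
  subtraction is exact because \<open>e \<le> d\<close>; for finite \<open>Q\<close> there are finitely many such \<open>e\<close>, so
  the \<^const>\<open>Min\<close> below is a genuine minimum.
\<close>

definition eff_competitors ::
    "('v, 'a) pre_digraph \<Rightarrow> ('v \<Rightarrow> real) \<Rightarrow> ('v \<Rightarrow> nat) \<Rightarrow> real \<Rightarrow> ('v \<Rightarrow> nat) set" where
  "eff_competitors Q \<kappa> d \<delta> =
    {e. dimension_vector Q e \<and> e \<noteq> (\<lambda>_. 0) \<and> e \<le> d \<and>
        euler_form Q e (\<lambda>i. d i - e i) \<ge> 0 \<and>
        functional Q \<kappa> e \<le> \<delta> * functional Q \<kappa> d}"

definition eps_eff ::
    "('v, 'a) pre_digraph \<Rightarrow> ('v \<Rightarrow> real) \<Rightarrow> ('v \<Rightarrow> real) \<Rightarrow> ('v \<Rightarrow> nat) \<Rightarrow> real \<Rightarrow> ereal" where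
  "eps_eff Q \<theta> \<kappa> d \<delta> =
    (if eff_competitors Q \<kappa> d \<delta> = {} then \<infinity>
     else ereal (Min ((\<lambda>e. slope Q \<theta> \<kappa> d - slope Q \<theta> \<kappa> e) ` eff_competitors Q \<kappa> d \<delta>)))"

text \<open>
  A representation assigns to each vertex a finite-dimensional vector space over the field type
  \<open>'f\<close> (as the ring \<^const>\<open>class_ring\<close>), with underlying set in the type \<open>'b\<close>, and to each arrow
  a linear map. Values off \<open>verts Q\<close> and \<open>arcs Q\<close> are irrelevant.
\<close>

record ('v, 'a, 'f, 'b) quiver_rep =
  rep_space :: "'v \<Rightarrow> ('f, 'b) module"
  rep_map :: "'a \<Rightarrow> 'b \<Rightarrow> 'b"

definition is_rep :: "('v, 'a) pre_digraph \<Rightarrow> ('v, 'a, 'f::field, 'b) quiver_rep \<Rightarrow> bool" where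
  "is_rep Q V \<longleftrightarrow>
    (\<forall>i\<in>verts Q. vectorspace (class_ring :: 'f ring) (rep_space V i) \<and>
                 vectorspace.fin_dim (class_ring :: 'f ring) (rep_space V i)) \<and>
    (\<forall>a\<in>arcs Q. linear_map (class_ring :: 'f ring)
                  (rep_space V (tail Q a)) (rep_space V (head Q a)) (rep_map V a))"

definition rep_dim :: "('v, 'a) pre_digraph \<Rightarrow> ('v, 'a, 'f::field, 'b) quiver_rep \<Rightarrow> 'v \<Rightarrow> nat" where
  "rep_dim Q V =
    (\<lambda>i. if i \<in> verts Q then vectorspace.dim (class_ring :: 'f ring) (rep_space V i) else 0)"

text \<open>
  A subrepresentation is given by the family \<open>U\<close> of its underlying sets; \<open>restrict_rep V U\<close> is
  the same thing viewed as a representation.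
\<close>

definition is_subrep ::
    "('v, 'a) pre_digraph \<Rightarrow> ('v, 'a, 'f::field, 'b) quiver_rep \<Rightarrow> ('v \<Rightarrow> 'b set) \<Rightarrow> bool" where
  "is_subrep Q V U \<longleftrightarrow>
    (\<forall>i\<in>verts Q. subspace (class_ring :: 'f ring) (U i) (rep_space V i)) \<and>
    (\<forall>a\<in>arcs Q. rep_map V a ` U (tail Q a) \<subseteq> U (head Q a))"

definition nonzero_subrep ::
    "('v, 'a) pre_digraph \<Rightarrow> ('v, 'a, 'f::field, 'b) quiver_rep \<Rightarrow> ('v \<Rightarrow> 'b set) \<Rightarrow> bool" where
  "nonzero_subrep Q V U \<longleftrightarrow> is_subrep Q V U \<and> (\<exists>i\<in>verts Q. U i \<noteq> {\<zero>\<^bsub>rep_space V i\<^esub>})"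

definition restrict_rep ::
    "('v, 'a, 'f, 'b) quiver_rep \<Rightarrow> ('v \<Rightarrow> 'b set) \<Rightarrow> ('v, 'a, 'f, 'b) quiver_rep" where
  "restrict_rep V U = V\<lparr>rep_space := (\<lambda>i. (rep_space V i)\<lparr>carrier := U i\<rparr>)\<rparr>"

definition expander ::
    "('v, 'a) pre_digraph \<Rightarrow> ('v \<Rightarrow> real) \<Rightarrow> ('v \<Rightarrow> real) \<Rightarrow> real \<Rightarrow> real \<Rightarrow>
     ('v, 'a, 'f::field, 'b) quiver_rep \<Rightarrow> bool" where
  "expander Q \<theta> \<kappa> \<delta> \<epsilon> V \<longleftrightarrow>
    (\<forall>U. nonzero_subrep Q V U \<and>
         functional Q \<kappa> (rep_dim Q (restrict_rep V U)) \<le> \<delta> * functional Q \<kappa> (rep_dim Q V) \<longrightarrow>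
         slope Q \<theta> \<kappa> (rep_dim Q (restrict_rep V U)) < slope Q \<theta> \<kappa> (rep_dim Q V) - \<epsilon>)"

text \<open>Families and sequences are indexed by \<open>k \<ge> 1\<close>; the value at \<open>0\<close> is ignored.\<close>

definition uniform_expander ::
    "('v, 'a) pre_digraph \<Rightarrow> ('v \<Rightarrow> real) \<Rightarrow> ('v \<Rightarrow> real) \<Rightarrow>
     (nat \<Rightarrow> ('v, 'a, 'f::field, 'b) quiver_rep) \<Rightarrow> bool" where
  "uniform_expander Q \<theta> \<kappa> V \<longleftrightarrow>
    (\<forall>k\<ge>1. is_rep Q (V k)) \<and>
    unbounded_dims Q (\<lambda>k. rep_dim Q (V k)) \<and>
    (\<forall>\<delta>. 0 < \<delta> \<and> \<delta> < 1 \<longrightarrow> (\<exists>\<epsilon>>0. \<forall>k\<ge>1. expander Q \<theta> \<kappa> \<delta> \<epsilon> (V k)))"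

text \<open>
  The existential quantifier must range over representations in a fixed type. The type
  \<^typ>\<open>'f vec\<close> contains a copy of every finite-dimensional space over \<open>'f\<close>, so up to isomorphism
  all representations are covered.
\<close>

definition supports_uniform_expander ::
    "'f::field itself \<Rightarrow> ('v, 'a) pre_digraph \<Rightarrow> ('v \<Rightarrow> real) \<Rightarrow> ('v \<Rightarrow> real) \<Rightarrow>
     (nat \<Rightarrow> 'v \<Rightarrow> nat) \<Rightarrow> bool" where
  "supports_uniform_expander _ Q \<theta> \<kappa> d \<longleftrightarrow>
    (\<exists>V :: nat \<Rightarrow> ('v, 'a, 'f, 'f vec) quiver_rep.
       uniform_expander Q \<theta> \<kappa> V \<and> (\<forall>k\<ge>1. rep_dim Q (V k) = d k))"

end

theory Submission
  imports Defs
begin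

text \<open>
  The hypothesis only sees dimension vectors \<open>e\<close> with \<open>\<langle>e, d - e\<rangle> \<ge> 0\<close>. So it suffices to
  find, for each dimension vector \<open>d\<close>, one representation \<open>V\<close> of dimension \<open>d\<close> all of whose
  subrepresentations have a dimension vector of this kind
  (\<open>generic_subrep_euler_form_nonneg\<close>): the dimension vector of a nonzero subrepresentation \<open>U\<close>
  with \<open>\<kappa>(U) \<le> \<delta> \<kappa>(V)\<close> then competes in \<open>eps_eff\<close>, whence \<open>\<mu>(U) \<le> \<mu>(V) - \<epsilon>(\<delta>)\<close>. Halving
  \<open>\<epsilon>(\<delta>)\<close> makes the inequality strict.

  Such a \<open>V\<close> exists by a dimension count. The representations of dimension \<open>d\<close> on coordinate
  spaces form an affine space. Consider those with a subrepresentation of dimension \<open>e\<close>. The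
  subspaces \<open>U\<^sub>i\<close> run through a product of Grassmannians, of dimension \<open>\<Sum>\<^sub>i e\<^sub>i (d\<^sub>i - e\<^sub>i)\<close>, and
  once they are chosen each arrow \<open>t \<rightarrow> h\<close> imposes \<open>e\<^sub>t (d\<^sub>h - e\<^sub>h)\<close> linear conditions on its
  matrix. Altogether these representations depend on \<open>\<langle>e, d - e\<rangle>\<close> more parameters than the
  affine space has dimensions. If this number is negative they fill only a proper closed subset,
  and over an infinite field finitely many proper closed subsets do not cover the affine space.

  The count needs no algebraic geometry. In the standard charts of the Grassmannians, indexed by
  sets of pivot coordinates (\<open>subspace_reduced_basis\<close>), the parametrisation is an explicit
  polynomial map (\<open>subrep_imp_in_chart_image\<close>). A polynomial map from fewer to more
  variables satisfies a nontrivial polynomial relation, by comparing the numbers of monomials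
  (\<open>algebraic_relation\<close>), and finitely many nonzero polynomials have a common point where none
  of them vanishes (\<open>polyfun_common_nonzero\<close>).
\<close>
section \<open>Polynomial functions and algebraic relations\<close>

lemma homogeneous_system_nontrivial_solution:
  fixes r :: "'a \<Rightarrow> 'b \<Rightarrow> 'f::field"
  assumes "finite B" "finite A" "card B < card A"
  shows "\<exists>c. (\<exists>a\<in>A. c a \<noteq> 0) \<and> (\<forall>b\<in>B. (\<Sum>a\<in>A. c a * r a b) = 0)"
  using assms
proof (induction B arbitrary: A r rule: finite_induct)
  case empty
  then have "A \<noteq> {}" by auto
  then show ?case by (intro exI[of _ "\<lambda>_. 1"]) auto
next
  case (insert b B)
  show ?case
  proof (cases "\<forall>a\<in>A. r a b = 0")
    case True
    obtain c where c: "\<exists>a\<in>A. c a \<noteq> 0" "\<forall>b\<in>B. (\<Sum>a\<in>A. c a * r a b) = 0"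
      using insert.IH[of A r] insert.hyps insert.prems by auto
    then show ?thesis using True by (intro exI[of _ c]) auto
  next
    case False
    then obtain a0 where a0: "a0 \<in> A" "r a0 b \<noteq> 0" by auto
    define A' where "A' = A - {a0}"
    have fin: "finite A'" "a0 \<notin> A'" "A = insert a0 A'" using a0 insert.prems by (auto simp: A'_def)
    \<comment> \<open>Gaussian elimination: the equation at \<open>b\<close> expresses the unknown \<open>c a0\<close> by the others.\<close>
    define r' where "r' = (\<lambda>a b'. r a b' - r a b / r a0 b * r a0 b')"
    have "card B < card A'" using insert.hyps insert.prems fin by auto
    from insert.IH[OF fin(1) this, of r'] obtain c where
      c: "\<exists>a\<in>A'. c a \<noteq> 0" "\<forall>b\<in>B. (\<Sum>a\<in>A'. c a * r' a b) = 0" by auto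
    define s where "s = (\<Sum>a\<in>A'. c a * r a b)"
    define c' where "c' = c(a0 := - s / r a0 b)"
    have c'sum: "(\<Sum>a\<in>A. c' a * r a b') = - s / r a0 b * r a0 b' + (\<Sum>a\<in>A'. c a * r a b')" for b'
    proof -
      have "(\<Sum>a\<in>A'. c' a * r a b') = (\<Sum>a\<in>A'. c a * r a b')"
        using fin(2) by (intro sum.cong) (auto simp: c'_def)
      then show ?thesis unfolding fin(3) using fin(1,2) by (simp add: c'_def)
    qed
    have "(\<Sum>a\<in>A. c' a * r a b') = 0" if "b' \<in> B" for b'
    proof -
      have "0 = (\<Sum>a\<in>A'. c a * r' a b')" using c(2) that by simp
      also have "\<dots> = (\<Sum>a\<in>A'. c a * r a b' - c a * r a b * (r a0 b' / r a0 b))"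
        by (intro sum.cong) (auto simp: r'_def algebra_simps)
      also have "\<dots> = (\<Sum>a\<in>A'. c a * r a b') - s * (r a0 b' / r a0 b)"
        by (simp only: sum_subtractf s_def sum_distrib_right)
      finally show ?thesis by (simp add: c'sum)
    qed
    moreover have "(\<Sum>a\<in>A. c' a * r a b) = 0" using a0 by (simp add: c'sum s_def)
    moreover have "\<exists>a\<in>A. c' a \<noteq> 0"
      using c(1) fin by (auto simp: c'_def)
    ultimately show ?thesis by (intro exI[of _ c']) auto
  qed
qed

text \<open>
  Polynomials are represented by the functions that they define; over an infinite field nothing is
  lost. The set \<open>M\<close> of variables may be smaller than the type, so that infinite types can serve as
  index types.
\<close>
inductive polyfun :: "'m set \<Rightarrow> (('m \<Rightarrow> 'f::field) \<Rightarrow> 'f) \<Rightarrow> bool" for M where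
  polyfun_const: "polyfun M (\<lambda>_. c)"
| polyfun_var: "m \<in> M \<Longrightarrow> polyfun M (\<lambda>x. x m)"
| polyfun_add: "polyfun M f \<Longrightarrow> polyfun M g \<Longrightarrow> polyfun M (\<lambda>x. f x + g x)"
| polyfun_mult: "polyfun M f \<Longrightarrow> polyfun M g \<Longrightarrow> polyfun M (\<lambda>x. f x * g x)"

lemma polyfun_diff: "polyfun M f \<Longrightarrow> polyfun M g \<Longrightarrow> polyfun M (\<lambda>x. f x - g x)"
  using polyfun_add[OF _ polyfun_mult[OF polyfun_const[of M "- 1"]], of f g] by simp

lemma polyfun_sum: "(\<And>i. i \<in> I \<Longrightarrow> polyfun M (f i)) \<Longrightarrow> polyfun M (\<lambda>x. \<Sum>i\<in>I. f i x)"
  by (induction I rule: infinite_finite_induct) (auto intro: polyfun_const polyfun_add)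

lemma polyfun_prod: "(\<And>i. i \<in> I \<Longrightarrow> polyfun M (f i)) \<Longrightarrow> polyfun M (\<lambda>x. \<Prod>i\<in>I. f i x)"
  by (induction I rule: infinite_finite_induct) (auto intro: polyfun_const polyfun_mult)

lemma polyfun_power: "polyfun M f \<Longrightarrow> polyfun M (\<lambda>x. f x ^ n)"
  by (induction n) (auto intro: polyfun_const polyfun_mult)

lemma polyfun_on_line:
  assumes "polyfun M f"
  shows "\<exists>p. \<forall>t. f (\<lambda>m. x m + t * (y m - x m)) = poly p t"
  using assms
proof induction
  case (polyfun_const c)
  show ?case by (rule exI[of _ "[:c:]"]) simp
next
  case (polyfun_var m)
  show ?case by (rule exI[of _ "[:x m, y m - x m:]"]) simp
next
  case (polyfun_add f g)
  then obtain p q where "\<forall>t. f (\<lambda>m. x m + t * (y m - x m)) = poly p t"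
    "\<forall>t. g (\<lambda>m. x m + t * (y m - x m)) = poly q t" by blast
  then show ?case by (intro exI[of _ "p + q"]) simp
next
  case (polyfun_mult f g)
  then obtain p q where "\<forall>t. f (\<lambda>m. x m + t * (y m - x m)) = poly p t"
    "\<forall>t. g (\<lambda>m. x m + t * (y m - x m)) = poly q t" by blast
  then show ?case by (intro exI[of _ "p * q"]) simp
qed

text \<open>
  Affine space over an infinite field is irreducible: on the line through a point where \<open>f\<close> does
  not vanish and a point where \<open>g\<close> does not vanish, both are nonzero polynomials in one variable,
  and their product has only finitely many roots.
\<close>
lemma polyfun_common_nonzero:
  fixes P :: "'i \<Rightarrow> ('m \<Rightarrow> 'f::field) \<Rightarrow> 'f"
  assumes "infinite (UNIV :: 'f set)" "finite I"
    and "\<And>i. i \<in> I \<Longrightarrow> polyfun M (P i)" "\<And>i. i \<in> I \<Longrightarrow> \<exists>x. P i x \<noteq> 0"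
  shows "\<exists>x. \<forall>i\<in>I. P i x \<noteq> 0"
  using assms(2-)
proof (induction I rule: finite_induct)
  case (insert i I)
  have "\<exists>x. \<forall>j\<in>I. P j x \<noteq> 0"
    by (rule insert.IH) (rule insert.prems, simp)+
  then obtain x where x: "\<forall>j\<in>I. P j x \<noteq> 0" ..
  obtain y where y: "P i y \<noteq> 0" using insert.prems(2)[OF insertI1] ..
  let ?l = "\<lambda>t m. x m + t * (y m - x m)"
  let ?F = "\<lambda>x. (\<Prod>j\<in>I. P j x)"
  have "polyfun M ?F" "polyfun M (P i)"
    by (intro polyfun_prod insert.prems(1); simp)+
  from this[THEN polyfun_on_line[where x = x and y = y]]
  obtain p q where p: "\<And>t. ?F (?l t) = poly p t" and q: "\<And>t. P i (?l t) = poly q t"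
    by auto
  have "?F x \<noteq> 0" using x insert.hyps(1) by (simp add: prod_zero_iff)
  then have "poly p 0 \<noteq> 0" using p[of 0] by simp
  moreover have "poly q 1 \<noteq> 0" using q[of 1] y by simp
  ultimately have "p * q \<noteq> 0" by auto
  then have "finite {t. poly (p * q) t = 0}" by (rule poly_roots_finite)
  then obtain t where "poly (p * q) t \<noteq> 0"
    using assms(1) by (metis (mono_tags, lifting) UNIV_eq_I mem_Collect_eq)
  then have "?F (?l t) \<noteq> 0" "P i (?l t) \<noteq> 0" using p q by auto
  then show ?case using insert.hyps by (intro exI[of _ "?l t"]) auto
qed auto

definition monomial :: "'m set \<Rightarrow> ('m \<Rightarrow> nat) \<Rightarrow> ('m \<Rightarrow> 'f::field) \<Rightarrow> 'f" where
  "monomial M a x = (\<Prod>m\<in>M. x m ^ a m)"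

text \<open>
  Induction on the variables: as a polynomial in the last variable, the linear combination has a
  coefficient that, by the induction hypothesis, is nonzero at some point for the others.
\<close>
lemma monomials_linearly_independent:
  fixes c :: "('m \<Rightarrow> nat) \<Rightarrow> 'f::field"
  assumes "infinite (UNIV :: 'f set)" "finite N"
    and "a \<in> N \<rightarrow>\<^sub>E {..D}" "c a \<noteq> 0"
  shows "\<exists>x. (\<Sum>a\<in>N \<rightarrow>\<^sub>E {..D}. c a * monomial N a x) \<noteq> 0"
  using assms(2-)
proof (induction N arbitrary: a c rule: finite_induct)
  case empty
  then show ?case by (auto simp: monomial_def)
next
  case (insert n N)
  let ?E = "N \<rightarrow>\<^sub>E {..D}"
  define h where "h = (\<lambda>(j, b). b(n := j) :: 'm \<Rightarrow> nat)"
  have inj: "inj_on h ({..D} \<times> ?E)"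
    using inj_combinator[OF insert.hyps(2), of "\<lambda>_. {..D}"] by (simp add: h_def)
  have img: "insert n N \<rightarrow>\<^sub>E {..D} = h ` ({..D} \<times> ?E)"
    by (simp add: h_def PiE_insert_eq)
  obtain j b where jb: "j \<le> D" "b \<in> ?E" "a = b(n := j)"
    using insert.prems(1) unfolding img by (auto simp: h_def)
  obtain x where x: "(\<Sum>b\<in>?E. c (b(n := j)) * monomial N b x) \<noteq> 0"
    using insert.IH[OF jb(2), of "\<lambda>b. c (b(n := j))"] insert.prems(2) jb(3) by metis
  define p where "p = (\<Sum>i\<le>D. monom (\<Sum>b\<in>?E. c (b(n := i)) * monomial N b x) i)"
  have "coeff p j \<noteq> 0" using x jb by (simp add: p_def coeff_sum)
  then have "p \<noteq> 0" by auto
  then have "finite {t. poly p t = 0}" by (rule poly_roots_finite)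
  then obtain t where t: "poly p t \<noteq> 0"
    using assms(1) by (metis (mono_tags, lifting) UNIV_eq_I mem_Collect_eq)
  have mon: "monomial (insert n N) (b(n := i)) (x(n := t)) = t ^ i * monomial N b x" for b i
  proof -
    have "(\<Prod>m\<in>N. (x(n := t)) m ^ (b(n := i)) m) = (\<Prod>m\<in>N. x m ^ b m)"
      using insert.hyps by (intro prod.cong) auto
    then show ?thesis using insert.hyps by (simp add: monomial_def)
  qed
  have "(\<Sum>a\<in>insert n N \<rightarrow>\<^sub>E {..D}. c a * monomial (insert n N) a (x(n := t)))
      = (\<Sum>(i, b)\<in>{..D} \<times> ?E. c (b(n := i)) * (t ^ i * monomial N b x))"
    unfolding img using inj
    by (subst sum.reindex) (auto simp: h_def mon intro!: sum.cong)
  also have "\<dots> = (\<Sum>i\<le>D. \<Sum>b\<in>?E. c (b(n := i)) * (t ^ i * monomial N b x))"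
    by (rule sum.cartesian_product[symmetric])
  also have "\<dots> = poly p t"
    by (simp add: p_def poly_sum poly_monom sum_distrib_left sum_distrib_right mult_ac)
  finally show ?case using t by metis
qed

text \<open>
  The bound \<open>k\<close> is on the exponent of each variable separately, not on the total degree. The
  exponent vectors then form a box, and counting monomials gives the power \<open>(k + 1) ^ card M\<close>.
\<close>
definition poly_deg :: "'m set \<Rightarrow> nat \<Rightarrow> (('m \<Rightarrow> 'f::field) \<Rightarrow> 'f) \<Rightarrow> bool" where
  "poly_deg M k f \<longleftrightarrow> (\<exists>c. f = (\<lambda>x. \<Sum>a\<in>M \<rightarrow>\<^sub>E {..k}. c a * monomial M a x))"

text \<open>
  The coefficients are allowed to come from any finite index set, several indices contributing to
  the same monomial. This is the shape in which products of polynomials arise.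
\<close>
lemma poly_degI:
  fixes C :: "'p \<Rightarrow> 'f::field"
  assumes "finite M" "finite P" "\<And>p. p \<in> P \<Longrightarrow> g p \<in> M \<rightarrow> {..k}"
    and "\<And>x. f x = (\<Sum>p\<in>P. C p * monomial M (g p) x)"
  shows "poly_deg M k f"
proof -
  let ?E = "M \<rightarrow>\<^sub>E {..k}"
  let ?g = "\<lambda>p. restrict (g p) M"
  define c where "c = (\<lambda>a. \<Sum>p\<in>{p \<in> P. ?g p = a}. C p)"
  have "f x = (\<Sum>a\<in>?E. c a * monomial M a x)" for x
  proof -
    have "?g ` P \<subseteq> ?E" using assms(3) by (force simp: Pi_iff)
    moreover have "finite ?E" using assms(1) by (simp add: finite_PiE)
    ultimately have "(\<Sum>p\<in>P. C p * monomial M (g p) x)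
        = (\<Sum>a\<in>?E. \<Sum>p\<in>{p \<in> P. ?g p = a}. C p * monomial M (g p) x)"
      by (intro sum.group[symmetric] assms(2)) auto
    also have "\<dots> = (\<Sum>a\<in>?E. c a * monomial M a x)"
      unfolding c_def sum_distrib_right
      by (intro sum.cong refl) (auto simp: monomial_def)
    finally show ?thesis using assms(4) by simp
  qed
  then show ?thesis unfolding poly_deg_def by blast
qed

lemma poly_deg_mono:
  assumes "finite M" "poly_deg M k f" "k \<le> l"
  shows "poly_deg M l f"
proof -
  from assms(2) obtain c where c: "f = (\<lambda>x. \<Sum>a\<in>M \<rightarrow>\<^sub>E {..k}. c a * monomial M a x)"
    unfolding poly_deg_def by auto
  show ?thesis
  proof (rule poly_degI[where P = "M \<rightarrow>\<^sub>E {..k}" and g = "\<lambda>a. a" and C = c])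
    show "a \<in> M \<rightarrow> {..l}" if "a \<in> M \<rightarrow>\<^sub>E {..k}" for a
    proof
      fix m assume "m \<in> M"
      then have "a m \<le> k" using PiE_mem[OF that] by simp
      then show "a m \<in> {..l}" using assms(3) by simp
    qed
  qed (use assms(1) c in \<open>simp_all add: finite_PiE\<close>)
qed

lemma poly_deg_const: "finite M \<Longrightarrow> poly_deg M k (\<lambda>_. c)"
  by (rule poly_degI[where P = "{()}" and g = "\<lambda>_ _. 0" and C = "\<lambda>_. c"]) (auto simp: monomial_def)

lemma poly_deg_var:
  assumes "finite M" "m \<in> M" shows "poly_deg M 1 (\<lambda>x. x m)"
proof (rule poly_degI[where P = "{()}" and g = "\<lambda>_ m'. of_bool (m' = m)" and C = "\<lambda>_. 1"])
  fix x :: "'a \<Rightarrow> 'b"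
  have "monomial M (\<lambda>m'. of_bool (m' = m)) x = (\<Prod>m'\<in>M. if m' = m then x m' else 1)"
    unfolding monomial_def by (intro prod.cong) auto
  then show "x m = (\<Sum>p\<in>{()}. 1 * monomial M (\<lambda>m'. of_bool (m' = m)) x)" using assms by simp
qed (use assms in auto)

lemma poly_deg_add:
  assumes "finite M" "poly_deg M k f" "poly_deg M k g"
  shows "poly_deg M k (\<lambda>x. f x + g x)"
proof -
  from assms(2,3) obtain c d where "f = (\<lambda>x. \<Sum>a\<in>M \<rightarrow>\<^sub>E {..k}. c a * monomial M a x)"
    "g = (\<lambda>x. \<Sum>a\<in>M \<rightarrow>\<^sub>E {..k}. d a * monomial M a x)"
    unfolding poly_deg_def by auto
  then show ?thesis unfolding poly_deg_def
    by (intro exI[of _ "\<lambda>a. c a + d a"]) (simp add: sum.distrib ring_distribs)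
qed

lemma poly_deg_mult:
  assumes "finite M" "poly_deg M k f" "poly_deg M l g"
  shows "poly_deg M (k + l) (\<lambda>x. f x * g x)"
proof -
  from assms(2,3) obtain c d where cd: "f = (\<lambda>x. \<Sum>a\<in>M \<rightarrow>\<^sub>E {..k}. c a * monomial M a x)"
    "g = (\<lambda>x. \<Sum>a\<in>M \<rightarrow>\<^sub>E {..l}. d a * monomial M a x)"
    unfolding poly_deg_def by auto
  show ?thesis
  proof (rule poly_degI[where P = "(M \<rightarrow>\<^sub>E {..k}) \<times> (M \<rightarrow>\<^sub>E {..l})"
        and g = "\<lambda>p m. fst p m + snd p m" and C = "\<lambda>p. c (fst p) * d (snd p)"])
    fix x
    show "f x * g x = (\<Sum>p\<in>(M \<rightarrow>\<^sub>E {..k}) \<times> (M \<rightarrow>\<^sub>E {..l}).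
        c (fst p) * d (snd p) * monomial M (\<lambda>m. fst p m + snd p m) x)"
      by (simp add: cd sum_product sum.cartesian_product monomial_def power_add prod.distrib
          split_def mult_ac)
  next
    fix p assume "p \<in> (M \<rightarrow>\<^sub>E {..k}) \<times> (M \<rightarrow>\<^sub>E {..l})"
    then show "(\<lambda>m. fst p m + snd p m) \<in> M \<rightarrow> {..k + l}"
      by (auto simp: PiE_iff add_mono)
  qed (use assms in \<open>auto simp: finite_PiE\<close>)
qed

lemma polyfun_imp_poly_deg:
  assumes "polyfun M f" "finite M" shows "\<exists>k. poly_deg M k f"
  using assms
proof induction
  case (polyfun_add f g)
  then obtain k l where "poly_deg M k f" "poly_deg M l g" by auto
  then have "poly_deg M (max k l) f" "poly_deg M (max k l) g"
    using poly_deg_mono[OF polyfun_add.prems] by (metis max.cobounded1 max.cobounded2)+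
  then show ?case using poly_deg_add polyfun_add.prems by blast
qed (blast intro: poly_deg_const poly_deg_var poly_deg_mult)+

lemma poly_deg_power:
  assumes "finite M" "poly_deg M k f" shows "poly_deg M (j * k) (\<lambda>x. f x ^ j)"
proof (induction j)
  case (Suc j)
  then show ?case using poly_deg_mult[OF assms Suc] by simp
qed (simp add: poly_deg_const[OF assms(1)])

lemma poly_deg_prod:
  assumes "finite M" "\<And>i. i \<in> I \<Longrightarrow> poly_deg M k (f i)"
  shows "poly_deg M (card I * k) (\<lambda>x. \<Prod>i\<in>I. f i x)"
  using assms(2)
proof (induction I rule: infinite_finite_induct)
  case (insert i I)
  have "poly_deg M (k + card I * k) (\<lambda>x. f i x * (\<Prod>i\<in>I. f i x))"
    using insert by (intro poly_deg_mult assms(1)) auto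
  then show ?case using insert.hyps by simp
qed (auto intro: poly_deg_const assms(1))

text \<open>
  Substituting the \<open>\<phi> n\<close> into the monomials in \<open>N\<close> with exponents at most \<open>D\<close> turns these
  \<open>(D + 1) ^ card N\<close> monomials into polynomials in the variables \<open>M\<close> with exponents \<open>O(D)\<close>.
  Those lie in a space of dimension \<open>O(D ^ card M)\<close>. For large \<open>D\<close> the substituted monomials are
  therefore linearly dependent, and the dependency is the relation \<open>P\<close>.
\<close>
lemma algebraic_relation:
  fixes \<phi> :: "'n \<Rightarrow> ('m \<Rightarrow> 'f::field) \<Rightarrow> 'f"
  assumes inf: "infinite (UNIV :: 'f set)" and fin: "finite N" "finite M"
    and card: "card M < card N"
    and poly: "\<And>n. n \<in> N \<Longrightarrow> polyfun M (\<phi> n)"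
  shows "\<exists>P. polyfun N P \<and> (\<exists>x. P x \<noteq> 0) \<and>
             (\<forall>x y. (\<forall>n\<in>N. x n = \<phi> n y) \<longrightarrow> P x = 0)"
proof -
  obtain k0 where k0: "\<And>n. n \<in> N \<Longrightarrow> poly_deg M (k0 n) (\<phi> n)"
    using polyfun_imp_poly_deg[OF poly fin(2)] by metis
  define k where "k = (\<Sum>n\<in>N. k0 n)"
  have k: "poly_deg M k (\<phi> n)" if "n \<in> N" for n
    using poly_deg_mono[OF fin(2) k0] that fin(1) unfolding k_def by (simp add: member_le_sum)
  \<comment> \<open>Substitution multiplies the bound on the exponents by at most \<open>q\<close>, so the target has at most
    \<open>(q (D + 1)) ^ card M = D (D + 1) ^ card M\<close> monomials. This choice of \<open>D\<close> makes that
    smaller than \<open>(D + 1) ^ card N\<close>.\<close>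
  define q where "q = card N * k + 1"
  define D where "D = q ^ card M"
  define K where "K = card N * (D * k)"
  let ?A = "N \<rightarrow>\<^sub>E {..D}" and ?B = "M \<rightarrow>\<^sub>E {..K}"
  have finA: "finite ?A" "finite ?B" using fin by (auto simp: finite_PiE)
  have cards: "card ?B < card ?A"
  proof -
    have "K + 1 \<le> q * (D + 1)" by (simp add: K_def q_def algebra_simps)
    then have "(K + 1) ^ card M \<le> (q * (D + 1)) ^ card M" by (rule power_mono) simp
    also have "\<dots> = D * (D + 1) ^ card M" by (simp only: power_mult_distrib flip: D_def)
    also have "\<dots> < (D + 1) * (D + 1) ^ card M" by simp
    also have "\<dots> = (D + 1) ^ Suc (card M)" by simp
    also have "\<dots> \<le> (D + 1) ^ card N" using card by (intro power_increasing) auto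
    finally show ?thesis using fin by (simp add: card_PiE)
  qed
  have "poly_deg M K (\<lambda>y. monomial N a (\<lambda>n. \<phi> n y))" if "a \<in> ?A" for a
    unfolding monomial_def K_def
  proof (rule poly_deg_prod[OF fin(2)])
    fix n assume n: "n \<in> N"
    then have "a n * k \<le> D * k" using that by (auto simp: PiE_iff)
    then show "poly_deg M (D * k) (\<lambda>y. \<phi> n y ^ a n)"
      using poly_deg_mono[OF fin(2) poly_deg_power[OF fin(2) k[OF n]]] by blast
  qed
  then have "\<forall>a\<in>?A. \<exists>c. (\<lambda>y. monomial N a (\<lambda>n. \<phi> n y)) = (\<lambda>y. \<Sum>b\<in>?B. c b * monomial M b y)"
    unfolding poly_deg_def by blast
  from bchoice[OF this] obtain r where r: "\<And>a. a \<in> ?A \<Longrightarrow>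
      (\<lambda>y. monomial N a (\<lambda>n. \<phi> n y)) = (\<lambda>y. \<Sum>b\<in>?B. r a b * monomial M b y)"
    by auto
  obtain c where c: "\<exists>a\<in>?A. c a \<noteq> 0" "\<And>b. b \<in> ?B \<Longrightarrow> (\<Sum>a\<in>?A. c a * r a b) = 0"
    using homogeneous_system_nontrivial_solution[OF finA(2,1) cards, of r] by blast
  define P where "P = (\<lambda>x. \<Sum>a\<in>?A. c a * monomial N a x)"
  have "polyfun N P"
    unfolding P_def monomial_def
    by (intro polyfun_sum polyfun_mult polyfun_const polyfun_prod polyfun_power polyfun_var)
  moreover have "\<exists>x. P x \<noteq> 0"
    using c(1) monomials_linearly_independent[OF inf fin(1)] unfolding P_def by blast
  moreover have "P x = 0" if "\<forall>n\<in>N. x n = \<phi> n y" for x y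
  proof -
    have "P x = (\<Sum>a\<in>?A. c a * (\<Sum>b\<in>?B. r a b * monomial M b y))"
      unfolding P_def
    proof (rule sum.cong[OF refl])
      fix a assume a: "a \<in> ?A"
      have "monomial N a x = monomial N a (\<lambda>n. \<phi> n y)"
        unfolding monomial_def using that by (intro prod.cong) auto
      then show "c a * monomial N a x = c a * (\<Sum>b\<in>?B. r a b * monomial M b y)"
        using fun_cong[OF r[OF a], of y] by simp
    qed
    also have "\<dots> = (\<Sum>b\<in>?B. (\<Sum>a\<in>?A. c a * r a b) * monomial M b y)"
      unfolding sum_distrib_left sum_distrib_right by (subst sum.swap) (simp add: mult_ac)
    also have "\<dots> = 0" using c(2) by simp
    finally show ?thesis .
  qed
  ultimately show ?thesis by blast
qed


text \<open>
  Over a finite field, adding \<open>1\<close> to the product of all linear factors \<open>X - a\<close> gives a nonconstant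
  polynomial without roots.
\<close>
lemma infinite_alg_closed_field: "infinite (UNIV :: 'f::alg_closed_field set)"
proof
  assume fin: "finite (UNIV :: 'f set)"
  define q where "q = (\<Prod>a\<in>(UNIV :: 'f set). [:- a, 1:])"
  have "degree q = (\<Sum>a\<in>(UNIV :: 'f set). degree [:- a, 1:])"
    unfolding q_def by (rule degree_prod_eq_sum_degree) auto
  also have "\<dots> > 0" using fin by (simp add: card_gt_0_iff)
  finally have "degree q > 0" .
  then have "degree (q + 1) > 0" by (subst degree_add_eq_left) auto
  then obtain x where "poly (q + 1) x = 0" using alg_closed_imp_poly_has_root by blast
  moreover have "poly q x = 0"
    unfolding q_def poly_prod using fin by (subst prod_zero_iff) (auto intro!: exI[of _ x])
  ultimately show False by simp
qed

section \<open>Charts of the Grassmannian\<close>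

text \<open>
  Up to the order of the coordinates, \<open>u\<close> lists the rows of a reduced echelon form of \<open>U\<close> with
  pivot coordinates \<open>S\<close>: the coordinates in \<open>S\<close> determine a vector of \<open>U\<close> and can be prescribed
  freely. The entries of \<open>u s\<close> outside \<open>S\<close> are the coordinates of \<open>U\<close> in the chart of the
  Grassmannian that belongs to \<open>S\<close>.
\<close>
definition reduced_basis :: "nat \<Rightarrow> 'f::field vec set \<Rightarrow> nat set \<Rightarrow> (nat \<Rightarrow> 'f vec) \<Rightarrow> bool" where
  "reduced_basis n U S u \<longleftrightarrow>
    S \<subseteq> {..<n} \<and> (\<forall>s\<in>S. u s \<in> U \<and> (\<forall>t\<in>S. u s $ t = of_bool (s = t))) \<and>
    (\<forall>v\<in>U. \<forall>i<n. v $ i = (\<Sum>s\<in>S. v $ s * u s $ i))"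

text \<open>
  The pivots are a maximal set \<open>S\<close> of coordinates that can be prescribed freely on \<open>U\<close>. A nonzero
  vector of \<open>U\<close> vanishing on \<open>S\<close> would allow adding another coordinate to \<open>S\<close>, by elimination.
  So restriction to \<open>S\<close> is an isomorphism, and \<open>card S\<close> is the dimension of \<open>U\<close>.
\<close>
lemma subspace_reduced_basis:
  fixes U :: "'f::field vec set"
  assumes sub: "subspace (class_ring :: 'f ring) U (module_vec TYPE('f) n)"
  shows "\<exists>S u. reduced_basis n U S u \<and>
           vectorspace.dim (class_ring :: 'f ring) ((module_vec TYPE('f) n)\<lparr>carrier := U\<rparr>) = card S"
proof -
  interpret V: vec_space "TYPE('f)" n .
  have submod: "submodule (class_ring :: 'f ring) U (module_vec TYPE('f) n)"
    using sub by (simp add: subspace_def)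
  interpret W: vectorspace "class_ring :: 'f ring" "(module_vec TYPE('f) n)\<lparr>carrier := U\<rparr>"
    using sub by (rule V.subspace_is_vs)
  have Uc: "v \<in> carrier_vec n" if "v \<in> U" for v
    using submodule.subset[OF submod] that by (auto simp: module_vec_simps)
  have add: "v + w \<in> U" if "v \<in> U" "w \<in> U" for v w
    using submodule.m_closed[OF submod that] by (simp add: module_vec_simps)
  have smult: "c \<cdot>\<^sub>v v \<in> U" if "v \<in> U" for v c
    using submodule.smult_closed[OF submod _ that, of c] by (simp add: module_vec_simps)

  define G where "G = {S. S \<subseteq> {..<n} \<and>
    (\<exists>u. \<forall>s\<in>S. u s \<in> U \<and> (\<forall>t\<in>S. u s $ t = of_bool (s = t)))}"
  have "G \<subseteq> Pow {..<n}" by (auto simp: G_def)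
  then have "finite G" by (rule finite_subset) simp
  moreover have "{} \<in> G" by (auto simp: G_def)
  ultimately obtain S where "S \<in> G" and maxi: "\<And>T. T \<in> G \<Longrightarrow> S \<subseteq> T \<Longrightarrow> S = T"
    using finite_has_maximal[of G] by blast
  then obtain u where S: "S \<subseteq> {..<n}" and u: "\<And>s. s \<in> S \<Longrightarrow> u s \<in> U"
    and ut: "\<And>s t. s \<in> S \<Longrightarrow> t \<in> S \<Longrightarrow> u s $ t = of_bool (s = t)"
    unfolding G_def by blast
  have finS: "finite S" using S finite_subset by blast

  have zero: "v $ i = 0" if v: "v \<in> U" "\<And>s. s \<in> S \<Longrightarrow> v $ s = 0" and i: "i < n" for v i
  proof (rule ccontr)
    assume nz: "v $ i \<noteq> 0"
    then have iS: "i \<notin> S" using v(2) by auto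
    define w where "w = (1 / v $ i) \<cdot>\<^sub>v v"
    have wU: "w \<in> U" unfolding w_def by (rule smult[OF v(1)])
    have wi: "w $ i = 1" and ws: "\<And>s. s \<in> S \<Longrightarrow> w $ s = 0"
      using Uc[OF v(1)] i nz v(2) S by (auto simp: w_def)
    define u' where "u' = (\<lambda>s. if s = i then w else u s + (- (u s $ i)) \<cdot>\<^sub>v w)"
    have "u' s \<in> U" if "s \<in> insert i S" for s
      using that wU u by (auto simp: u'_def intro!: add smult)
    moreover have "u' s $ t = of_bool (s = t)" if "s \<in> insert i S" "t \<in> insert i S" for s t
    proof -
      have "t < n" using that i S by auto
      then show ?thesis
        using that iS wi ws ut Uc[OF wU] Uc[OF u] by (auto simp: u'_def)
    qed
    moreover have "insert i S \<subseteq> {..<n}" using S i by auto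
    ultimately have "insert i S \<in> G" unfolding G_def by blast
    then show False using maxi iS by blast
  qed

  let ?B = "u ` S"
  have inj: "inj_on u S"
    by (rule inj_onI) (metis ut of_bool_eq_iff)
  have BU: "?B \<subseteq> U" and Bc: "?B \<subseteq> carrier_vec n" using u Uc by auto
  \<comment> \<open>The candidate for the expansion of \<open>v\<close>: the combination of the \<open>u s\<close> that agrees with \<open>v\<close>
    at the pivots.\<close>
  define co where "co = (\<lambda>v :: 'f vec. V.lincomb (\<lambda>b. v $ the_inv_into S u b) ?B)"
  have lc: "V.lincomb a ?B $ i = (\<Sum>s\<in>S. a (u s) * u s $ i)" if "i < n" for a i
    using V.lincomb_index[OF that Bc] inj by (simp add: sum.reindex)
  have co: "co v $ i = (\<Sum>s\<in>S. v $ s * u s $ i)" if "i < n" for v i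
    unfolding co_def lc[OF that] using inj by (intro sum.cong) (auto simp: the_inv_into_f_f)
  have coU: "co v \<in> V.span ?B" for v
    unfolding co_def V.span_def using finS by (auto simp: class_ring_simps)
  have spanU: "V.span ?B \<subseteq> U" using V.span_is_subset[OF BU submod] .
  have expand: "v $ i = co v $ i" if v: "v \<in> U" and i: "i < n" for v i
  proof -
    have coc: "co v \<in> U" "co v \<in> carrier_vec n" using coU spanU Uc by blast+
    have "(v + (- 1) \<cdot>\<^sub>v co v) $ i = 0"
    proof (rule zero[OF _ _ i])
      show "v + (- 1) \<cdot>\<^sub>v co v \<in> U" using coc v by (intro add smult)
      fix s assume s: "s \<in> S"
      then have "s < n" using S by auto
      moreover have "co v $ s = v $ s"
      proof -
        have "co v $ s = (\<Sum>t\<in>S. if t = s then v $ t else 0)"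
          unfolding co[OF \<open>s < n\<close>] using ut s by (intro sum.cong) auto
        then show ?thesis using finS s by simp
      qed
      ultimately show "(v + (- 1) \<cdot>\<^sub>v co v) $ s = 0" using coc Uc[OF v] by simp
    qed
    then show ?thesis using coc Uc[OF v] i by simp
  qed
  have "U \<subseteq> V.span ?B"
  proof
    fix v assume v: "v \<in> U"
    have "co v \<in> carrier_vec n" using coU[of v] spanU Uc by blast
    then have "v = co v" using expand[OF v] Uc[OF v] by (intro eq_vecI) auto
    then show "v \<in> V.span ?B" using coU by metis
  qed
  then have span: "V.span ?B = U" using spanU by auto
  have coeffs: "\<forall>v\<in>?B. a v = 0" if z: "V.lincomb a ?B = 0\<^sub>v n" for a
  proof -
    have "a (u s) = 0" if s: "s \<in> S" for s
    proof -
      have sn: "s < n" using s S by auto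
      have "0 = (\<Sum>t\<in>S. a (u t) * u t $ s)" using lc[OF sn, of a] z sn by simp
      also have "\<dots> = (\<Sum>t\<in>S. if t = s then a (u t) else 0)"
        using ut s by (intro sum.cong) auto
      finally show ?thesis using finS s by simp
    qed
    then show ?thesis by auto
  qed
  have indpt: "\<not> V.lin_dep ?B"
    by (rule V.finite_lin_indpt2) (use finS Bc coeffs in \<open>auto simp: module_vec_simps\<close>)
  have "W.basis ?B"
    unfolding W.basis_def using BU V.span_li_not_depend[OF BU submod] span indpt by simp
  then have "W.dim = card ?B" using finS by (intro W.dim_basis) auto
  then have "W.dim = card S" using inj by (simp add: card_image)
  moreover have "reduced_basis n U S u"
    unfolding reduced_basis_def
  proof (intro conjI ballI allI impI)
    show "v $ i = (\<Sum>s\<in>S. v $ s * u s $ i)" if "v \<in> U" "i < n" for v i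
      using expand[OF that] co[OF that(2)] by simp
  qed (fact S, fact u, fact ut)
  ultimately show ?thesis by blast
qed

section \<open>Representations in general position\<close>

text \<open>
  The representations on the coordinate spaces of dimensions \<open>d i\<close>. The matrix entries of all
  arrows together are one function \<open>x\<close>, a point of the affine space with coordinates
  \<open>arrow_entries Q d\<close> below.
\<close>
definition matrix_rep ::
    "('v, 'a) pre_digraph \<Rightarrow> ('v \<Rightarrow> nat) \<Rightarrow> ('a \<times> nat \<times> nat \<Rightarrow> 'f::field) \<Rightarrow>
     ('v, 'a, 'f, 'f vec) quiver_rep" where
  "matrix_rep Q d x = \<lparr>rep_space = (\<lambda>i. module_vec TYPE('f) (d i)),
     rep_map = (\<lambda>a v. mat (d (head Q a)) (d (tail Q a)) (\<lambda>(p, q). x (a, p, q)) *\<^sub>v v)\<rparr>"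

lemma linear_map_mult_mat_vec:
  fixes A :: "'f::field mat"
  assumes "A \<in> carrier_mat m n"
  shows "linear_map (class_ring :: 'f ring) (module_vec TYPE('f) n) (module_vec TYPE('f) m) ((*\<^sub>v) A)"
  unfolding linear_map_def mod_hom_def mod_hom_axioms_def module_hom_def
  using assms vec_vs[where 'a = 'f] vec_module[where 'a = 'f]
  by (auto simp: module_vec_simps class_ring_simps mult_add_distrib_mat_vec mult_mat_vec)

lemma is_rep_matrix_rep: "is_rep Q (matrix_rep Q d (x :: _ \<Rightarrow> 'f::field))"
  unfolding is_rep_def matrix_rep_def
  using vec_vs[where 'a = 'f] vec_space.fin_dim[where 'a = 'f]
  by (auto intro!: linear_map_mult_mat_vec)

lemma rep_dim_matrix_rep:
  assumes "dimension_vector Q d"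
  shows "rep_dim Q (matrix_rep Q d (x :: _ \<Rightarrow> 'f::field)) = d"
  using assms vec_space.dim_is_n[where 'a = 'f]
  by (auto simp: rep_dim_def matrix_rep_def dimension_vector_def)

lemma subrep_reduced_bases:
  assumes "is_subrep Q (matrix_rep Q d (x :: _ \<Rightarrow> 'f::field)) U"
  shows "\<exists>S u. (\<forall>i\<in>verts Q. reduced_basis (d i) (U i) (S i) (u i)) \<and>
    (\<forall>i. i \<notin> verts Q \<longrightarrow> S i = {}) \<and>
    rep_dim Q (restrict_rep (matrix_rep Q d x) U) = (\<lambda>i. card (S i))"
proof -
  have "\<forall>i\<in>verts Q. \<exists>S u. reduced_basis (d i) (U i) S u \<and>
      vectorspace.dim (class_ring :: 'f ring) ((module_vec TYPE('f) (d i))\<lparr>carrier := U i\<rparr>) = card S"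
  proof
    fix i assume "i \<in> verts Q"
    then have "subspace (class_ring :: 'f ring) (U i) (module_vec TYPE('f) (d i))"
      using assms by (simp add: is_subrep_def matrix_rep_def)
    from subspace_reduced_basis[OF this] show "\<exists>S u. reduced_basis (d i) (U i) S u \<and>
      vectorspace.dim (class_ring :: 'f ring) ((module_vec TYPE('f) (d i))\<lparr>carrier := U i\<rparr>) = card S" .
  qed
  then obtain S u where Su: "\<And>i. i \<in> verts Q \<Longrightarrow> reduced_basis (d i) (U i) (S i) (u i) \<and>
      vectorspace.dim (class_ring :: 'f ring) ((module_vec TYPE('f) (d i))\<lparr>carrier := U i\<rparr>) = card (S i)"
    by metis
  then show ?thesis
    by (intro exI[of _ "\<lambda>i. if i \<in> verts Q then S i else {}"] exI[of _ u])
       (auto simp: rep_dim_def restrict_rep_def matrix_rep_def)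
qed

lemma rep_dim_subrep_le:
  assumes "is_subrep Q (matrix_rep Q d (x :: _ \<Rightarrow> 'f::field)) U"
  shows "rep_dim Q (restrict_rep (matrix_rep Q d x) U) \<le> d"
proof -
  obtain S u where *: "\<forall>i\<in>verts Q. reduced_basis (d i) (U i) (S i) (u i)"
    "\<forall>i. i \<notin> verts Q \<longrightarrow> S i = {}"
    "rep_dim Q (restrict_rep (matrix_rep Q d x) U) = (\<lambda>i. card (S i))"
    using subrep_reduced_bases[OF assms] by blast
  have "card (S i) \<le> d i" for i
  proof (cases "i \<in> verts Q")
    case True
    then have "S i \<subseteq> {..<d i}" using *(1) by (auto simp: reduced_basis_def)
    then have "card (S i) \<le> card {..<d i}" by (intro card_mono) auto
    then show ?thesis by simp
  qed (use *(2) in auto)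
  then show ?thesis by (simp add: *(3) le_fun_def)
qed

lemma rep_dim_nonzero_subrep:
  assumes "nonzero_subrep Q (matrix_rep Q d (x :: _ \<Rightarrow> 'f::field)) U"
  shows "rep_dim Q (restrict_rep (matrix_rep Q d x) U) \<noteq> (\<lambda>_. 0)"
proof
  assume zero: "rep_dim Q (restrict_rep (matrix_rep Q d x) U) = (\<lambda>_. 0)"
  have sub: "is_subrep Q (matrix_rep Q d x) U" using assms by (simp add: nonzero_subrep_def)
  obtain S u where *: "\<forall>i\<in>verts Q. reduced_basis (d i) (U i) (S i) (u i)"
    "rep_dim Q (restrict_rep (matrix_rep Q d x) U) = (\<lambda>i. card (S i))"
    using subrep_reduced_bases[OF sub] by blast
  obtain i where i: "i \<in> verts Q" "U i \<noteq> {0\<^sub>v (d i)}"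
    using assms by (auto simp: nonzero_subrep_def matrix_rep_def module_vec_simps)
  have rb: "reduced_basis (d i) (U i) (S i) (u i)" using * i by blast
  then have "finite (S i)" using finite_subset by (auto simp: reduced_basis_def)
  then have S0: "S i = {}" using zero *(2) by (metis card_0_eq)
  have "submodule (class_ring :: 'f ring) (U i) (module_vec TYPE('f) (d i))"
    using sub i(1) by (auto simp: is_subrep_def matrix_rep_def subspace_def)
  then have "U i \<subseteq> carrier_vec (d i)" "0\<^sub>v (d i) \<in> U i"
    using submodule.subset submodule.zero_closed by (fastforce simp: module_vec_simps)+
  moreover have "v = 0\<^sub>v (d i)" if "v \<in> U i" "v \<in> carrier_vec (d i)" for v
    using rb that S0 by (intro eq_vecI) (auto simp: reduced_basis_def)
  ultimately show False using i(2) by blast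
qed

definition arrow_entries :: "('v, 'a) pre_digraph \<Rightarrow> ('v \<Rightarrow> nat) \<Rightarrow> ('a \<times> nat \<times> nat) set" where
  "arrow_entries Q d = (SIGMA a:arcs Q. {..<d (head Q a)} \<times> {..<d (tail Q a)})"

text \<open>
  These entries, with column a pivot at the tail and row not a pivot at the head, are the ones that
  the condition for \<open>U\<close> to be a subrepresentation expresses by the others. Their
  number is the dimension of \<open>Hom(U\<^sub>t, V\<^sub>h / U\<^sub>h)\<close>, summed over the arrows \<open>t \<rightarrow> h\<close>.
\<close>
definition dependent_entries ::
    "('v, 'a) pre_digraph \<Rightarrow> ('v \<Rightarrow> nat) \<Rightarrow> ('v \<Rightarrow> nat set) \<Rightarrow> ('a \<times> nat \<times> nat) set" where
  "dependent_entries Q d S =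
    (SIGMA a:arcs Q. ({..<d (head Q a)} - S (head Q a)) \<times> S (tail Q a))"

definition grassmannian_coords ::
    "('v, 'a) pre_digraph \<Rightarrow> ('v \<Rightarrow> nat) \<Rightarrow> ('v \<Rightarrow> nat set) \<Rightarrow> ('v \<times> nat \<times> nat) set" where
  "grassmannian_coords Q d S = (SIGMA i:verts Q. ({..<d i} - S i) \<times> S i)"

definition chart_parameters ::
    "('v, 'a) pre_digraph \<Rightarrow> ('v \<Rightarrow> nat) \<Rightarrow> ('v \<Rightarrow> nat set) \<Rightarrow>
     (('a \<times> nat \<times> nat) + ('v \<times> nat \<times> nat)) set" where
  "chart_parameters Q d S =
    (arrow_entries Q d - dependent_entries Q d S) <+> grassmannian_coords Q d S"

text \<open>
  The left summand of a parameter vector \<open>y\<close> holds the free matrix entries \<open>A\<^sub>r\<^sub>l\<close>, the right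
  summand the coordinates of the subspaces \<open>U\<^sub>i\<close>. Let \<open>w = A u\<^sub>q\<close> be the image of the basis vector
  of \<open>U\<^sub>t\<close> with pivot \<open>q\<close>. As \<open>u\<^sub>q\<close> is \<open>1\<close> at \<open>q\<close> and \<open>0\<close> at the other pivots, \<open>w\<^sub>r\<close> is \<open>A\<^sub>r\<^sub>q\<close> plus
  the contribution \<open>outside r\<close> of the coordinates that are not pivots. The condition \<open>w \<in> U\<^sub>h\<close>
  says that each coordinate \<open>w\<^sub>p\<close> is the combination, with coefficients \<open>w\<^sub>r\<close> for \<open>r \<in> S h\<close>, of
  the basis of \<open>U\<^sub>h\<close>. If \<open>p\<close> is not a pivot, this can be solved for \<open>A\<^sub>p\<^sub>q\<close>, and the right-hand
  side involves free entries only.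
\<close>
definition chart_map ::
    "('v, 'a) pre_digraph \<Rightarrow> ('v \<Rightarrow> nat) \<Rightarrow> ('v \<Rightarrow> nat set) \<Rightarrow> 'a \<times> nat \<times> nat \<Rightarrow>
     (('a \<times> nat \<times> nat) + ('v \<times> nat \<times> nat) \<Rightarrow> 'f::field) \<Rightarrow> 'f" where
  "chart_map Q d S = (\<lambda>(a, p, q) y.
    let h = head Q a; t = tail Q a;
        outside = (\<lambda>r. \<Sum>l\<in>{..<d t} - S t. y (Inl (a, r, l)) * y (Inr (t, l, q)))
    in if (a, p, q) \<in> dependent_entries Q d S
       then (\<Sum>r\<in>S h. (y (Inl (a, r, q)) + outside r) * y (Inr (h, p, r))) - outside p
       else y (Inl (a, p, q)))"

text \<open>
  The two sums in the Euler form are the dimension of the product of Grassmannians and the number of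
  dependent entries.
\<close>
lemma card_chart_parameters:
  assumes "fin_digraph Q" and S: "\<And>i. i \<in> verts Q \<Longrightarrow> S i \<subseteq> {..<d i}"
  shows "int (card (chart_parameters Q d S)) =
    int (card (arrow_entries Q d)) + euler_form Q (\<lambda>i. card (S i)) (\<lambda>i. d i - card (S i))"
proof -
  interpret fin_digraph Q by fact
  have finS: "finite (S i)" if "i \<in> verts Q" for i using S[OF that] finite_subset by blast
  have comp: "card ({..<d i} - S i) = d i - card (S i)" if "i \<in> verts Q" for i
    using S[OF that] finS[OF that] by (simp add: card_Diff_subset)
  have sub: "dependent_entries Q d S \<subseteq> arrow_entries Q d"
  proof
    fix n assume "n \<in> dependent_entries Q d S"
    then obtain a p q where "n = (a, p, q)" "a \<in> arcs Q" "p < d (head Q a)" "q \<in> S (tail Q a)"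
      by (auto simp: dependent_entries_def)
    moreover from this have "q < d (tail Q a)" using S[of "tail Q a"] by auto
    ultimately show "n \<in> arrow_entries Q d" by (simp add: arrow_entries_def)
  qed
  have finE: "finite (arrow_entries Q d)" by (auto simp: arrow_entries_def)
  have finG: "finite (grassmannian_coords Q d S)"
    using finS by (auto simp: grassmannian_coords_def)
  have "card (dependent_entries Q d S)
      = (\<Sum>a\<in>arcs Q. card (S (tail Q a)) * (d (head Q a) - card (S (head Q a))))"
    unfolding dependent_entries_def using finS
    by (subst card_SigmaI) (auto simp: card_cartesian_product comp mult.commute)
  moreover have "card (grassmannian_coords Q d S) = (\<Sum>i\<in>verts Q. card (S i) * (d i - card (S i)))"
    unfolding grassmannian_coords_def using finS
    by (subst card_SigmaI) (auto simp: card_cartesian_product comp mult.commute)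
  moreover have "card (dependent_entries Q d S) \<le> card (arrow_entries Q d)"
    using sub finE by (intro card_mono)
  ultimately show ?thesis
    using finE finG sub finite_subset[OF sub finE]
    by (simp add: chart_parameters_def card_Plus card_Diff_subset euler_form_def)
qed

lemma polyfun_chart_map:
  assumes "fin_digraph Q" and S: "\<And>i. i \<in> verts Q \<Longrightarrow> S i \<subseteq> {..<d i}"
    and n: "n \<in> arrow_entries Q d"
  shows "polyfun (chart_parameters Q d S) (chart_map Q d S n)"
proof -
  interpret fin_digraph Q by fact
  obtain a p q where [simp]: "n = (a, p, q)" by (cases n)
  let ?h = "head Q a" and ?t = "tail Q a"
  have a: "a \<in> arcs Q" "?h \<in> verts Q" "?t \<in> verts Q" "p < d ?h" "q < d ?t"
    using n by (auto simp: arrow_entries_def)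
  show ?thesis
  proof (cases "n \<in> dependent_entries Q d S")
    case False
    then have "Inl n \<in> chart_parameters Q d S" using n by (auto simp: chart_parameters_def)
    then show ?thesis using False by (simp add: chart_map_def polyfun_var)
  next
    case True
    then have pq: "p \<notin> S ?h" "q \<in> S ?t" by (auto simp: dependent_entries_def)
    have 1: "Inl (a, r, l) \<in> chart_parameters Q d S" if "r < d ?h" "l \<in> {..<d ?t} - S ?t" for r l
      using a that by (auto simp: chart_parameters_def arrow_entries_def dependent_entries_def)
    have 2: "Inl (a, r, q) \<in> chart_parameters Q d S" if "r \<in> S ?h" for r
      using a that S[OF a(2)]
      by (auto simp: chart_parameters_def arrow_entries_def dependent_entries_def)
    have 3: "Inr (?t, l, q) \<in> chart_parameters Q d S" if "l \<in> {..<d ?t} - S ?t" for l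
      using a that pq by (auto simp: chart_parameters_def grassmannian_coords_def)
    have 4: "Inr (?h, p, r) \<in> chart_parameters Q d S" if "r \<in> S ?h" for r
      using a that pq by (auto simp: chart_parameters_def grassmannian_coords_def)
    have "r < d ?h" if "r \<in> S ?h" for r using S[OF a(2)] that by auto
    then have "polyfun (chart_parameters Q d S) (\<lambda>y.
        (\<Sum>r\<in>S ?h. (y (Inl (a, r, q)) +
            (\<Sum>l\<in>{..<d ?t} - S ?t. y (Inl (a, r, l)) * y (Inr (?t, l, q)))) * y (Inr (?h, p, r)))
        - (\<Sum>l\<in>{..<d ?t} - S ?t. y (Inl (a, p, l)) * y (Inr (?t, l, q))))"
      using a by (intro polyfun_diff polyfun_sum polyfun_mult polyfun_add polyfun_var 1 2 3 4)
    then show ?thesis using True by (simp add: chart_map_def Let_def)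
  qed
qed

lemma subrep_imp_in_chart_image:
  fixes x :: "'a \<times> nat \<times> nat \<Rightarrow> 'f::field"
  assumes "fin_digraph Q" and sub: "is_subrep Q (matrix_rep Q d x) U"
    and basis: "\<And>i. i \<in> verts Q \<Longrightarrow> reduced_basis (d i) (U i) (S i) (u i)"
    and n: "n \<in> arrow_entries Q d"
  shows "x n = chart_map Q d S n (case_sum x (\<lambda>(i, t, s). u i s $ t))"
proof (cases "n \<in> dependent_entries Q d S")
  case False
  then show ?thesis by (cases n) (simp add: chart_map_def)
next
  case True
  interpret fin_digraph Q by fact
  obtain a p q where n_eq: "n = (a, p, q)" by (cases n)
  define h t where "h = head Q a" and "t = tail Q a"
  have a: "a \<in> arcs Q" "h \<in> verts Q" "t \<in> verts Q" "p < d h" "q < d t" "p \<notin> S h" "q \<in> S t"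
    using n True by (auto simp: n_eq arrow_entries_def dependent_entries_def h_def t_def)
  have St: "S t \<subseteq> {..<d t}" and uU: "u t q \<in> U t"
    and ut: "\<And>l. l \<in> S t \<Longrightarrow> u t q $ l = of_bool (q = l)"
    using basis[OF a(3)] a(7) unfolding reduced_basis_def by blast+
  have Sh: "S h \<subseteq> {..<d h}"
    and expand: "\<And>v. v \<in> U h \<Longrightarrow> v $ p = (\<Sum>r\<in>S h. v $ r * u h r $ p)"
    using basis[OF a(2)] a(4) unfolding reduced_basis_def by blast+
  define A where "A = mat (d h) (d t) (\<lambda>(p, q). x (a, p, q))"
  have "submodule (class_ring :: 'f ring) (U t) (module_vec TYPE('f) (d t))"
    using sub a by (auto simp: is_subrep_def matrix_rep_def subspace_def)
  then have "U t \<subseteq> carrier_vec (d t)" using submodule.subset by (fastforce simp: module_vec_simps)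
  then have uc: "u t q \<in> carrier_vec (d t)" using uU by auto
  have AU: "A *\<^sub>v u t q \<in> U h"
  proof -
    have "rep_map (matrix_rep Q d x) a ` U t \<subseteq> U h"
      using sub a(1) by (simp add: is_subrep_def h_def t_def)
    moreover have "rep_map (matrix_rep Q d x) a = (*\<^sub>v) A"
      by (simp add: matrix_rep_def A_def h_def t_def)
    ultimately show ?thesis using uU by auto
  qed
  let ?out = "\<lambda>r. \<Sum>l\<in>{..<d t} - S t. x (a, r, l) * u t q $ l"
  have coord: "(A *\<^sub>v u t q) $ r = x (a, r, q) + ?out r" if "r < d h" for r
  proof -
    have "(A *\<^sub>v u t q) $ r = (\<Sum>l<d t. x (a, r, l) * u t q $ l)"
      using that uc by (simp add: A_def scalar_prod_def lessThan_atLeast0)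
    also have "\<dots> = (\<Sum>l\<in>S t. x (a, r, l) * u t q $ l) + ?out r"
      using St by (subst sum.subset_diff[of "S t"]) auto
    also have "(\<Sum>l\<in>S t. x (a, r, l) * u t q $ l) = (\<Sum>l\<in>S t. if l = q then x (a, r, l) else 0)"
      using ut by (intro sum.cong) auto
    also have "\<dots> = x (a, r, q)"
      using a(7) St finite_subset[of "S t" "{..<d t}"] by simp
    finally show ?thesis .
  qed
  have "x (a, p, q) + ?out p = (A *\<^sub>v u t q) $ p" using coord a by simp
  also have "\<dots> = (\<Sum>r\<in>S h. (A *\<^sub>v u t q) $ r * u h r $ p)" by (rule expand[OF AU])
  also have "\<dots> = (\<Sum>r\<in>S h. (x (a, r, q) + ?out r) * u h r $ p)"
    using Sh coord by (intro sum.cong) auto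
  finally show ?thesis
    using True unfolding n_eq chart_map_def Let_def h_def t_def by (simp add: algebra_simps)
qed

text \<open>
  Each choice \<open>S\<close> of pivots with a negative Euler form gives a nonzero polynomial that vanishes on
  all representations with a subrepresentation in the chart of \<open>S\<close>. As there are finitely many
  choices, some \<open>x\<close> avoids the zeros of all these polynomials.
\<close>
lemma generic_subrep_euler_form_nonneg:
  fixes Q :: "('v, 'a) pre_digraph"
  assumes inf: "infinite (UNIV :: 'f::field set)" and Q: "fin_digraph Q"
  shows "\<exists>x :: 'a \<times> nat \<times> nat \<Rightarrow> 'f. \<forall>U. is_subrep Q (matrix_rep Q d x) U \<longrightarrow>
    (let e = rep_dim Q (restrict_rep (matrix_rep Q d x) U)
     in euler_form Q e (\<lambda>i. d i - e i) \<ge> 0)"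
proof -
  interpret fin_digraph Q by fact
  define I where "I = {S \<in> \<Pi>\<^sub>E i\<in>verts Q. Pow {..<d i}.
    euler_form Q (\<lambda>i. card (S i)) (\<lambda>i. d i - card (S i)) < 0}"
  have "I \<subseteq> (\<Pi>\<^sub>E i\<in>verts Q. Pow {..<d i})" by (auto simp: I_def)
  then have finI: "finite I" by (rule finite_subset) (auto intro!: finite_PiE)
  have "\<exists>P. polyfun (arrow_entries Q d) P \<and> (\<exists>x. P x \<noteq> (0 :: 'f)) \<and>
      (\<forall>x y. (\<forall>n\<in>arrow_entries Q d. x n = chart_map Q d S n y) \<longrightarrow> P x = 0)" if "S \<in> I" for S
  proof (rule algebraic_relation[OF inf])
    have S: "\<And>i. i \<in> verts Q \<Longrightarrow> S i \<subseteq> {..<d i}"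
      and neg: "euler_form Q (\<lambda>i. card (S i)) (\<lambda>i. d i - card (S i)) < 0"
      using that by (auto simp: I_def PiE_iff)
    show "card (chart_parameters Q d S) < card (arrow_entries Q d)"
      using card_chart_parameters[of Q S d, OF Q S] neg by simp
    show "finite (arrow_entries Q d)" by (auto simp: arrow_entries_def)
    then show "finite (chart_parameters Q d S)"
      using S by (auto simp: chart_parameters_def grassmannian_coords_def
          intro!: finite_SigmaI intro: finite_subset[OF S])
    show "polyfun (chart_parameters Q d S) (chart_map Q d S n)" if "n \<in> arrow_entries Q d" for n
      using polyfun_chart_map[OF Q S that] .
  qed
  then have "\<forall>S\<in>I. \<exists>P. polyfun (arrow_entries Q d) P \<and> (\<exists>x. P x \<noteq> (0 :: 'f)) \<and>
      (\<forall>x y. (\<forall>n\<in>arrow_entries Q d. x n = chart_map Q d S n y) \<longrightarrow> P x = 0)" by blast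
  from bchoice[OF this] obtain P where
    P: "\<And>S. S \<in> I \<Longrightarrow> polyfun (arrow_entries Q d) (P S)"
       "\<And>S. S \<in> I \<Longrightarrow> \<exists>x. P S x \<noteq> (0 :: 'f)"
       "\<And>S x y. S \<in> I \<Longrightarrow> (\<And>n. n \<in> arrow_entries Q d \<Longrightarrow> x n = chart_map Q d S n y) \<Longrightarrow> P S x = 0"
    by blast
  obtain x where x: "\<And>S. S \<in> I \<Longrightarrow> P S x \<noteq> 0"
    using polyfun_common_nonzero[OF inf finI, of "arrow_entries Q d" P] P(1,2) by blast
  have "euler_form Q e (\<lambda>i. d i - e i) \<ge> 0"
    if sub: "is_subrep Q (matrix_rep Q d x) U"
      and e: "e = rep_dim Q (restrict_rep (matrix_rep Q d x) U)" for U e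
  proof (rule ccontr)
    assume neg: "\<not> ?thesis"
    obtain S u where Su: "\<And>i. i \<in> verts Q \<Longrightarrow> reduced_basis (d i) (U i) (S i) (u i)"
      and eS: "e = (\<lambda>i. card (S i))"
      using subrep_reduced_bases[OF sub] e by blast
    \<comment> \<open>The family of pivot sets has to be undefined off the vertices to lie in the finite set \<open>I\<close>.\<close>
    define S' where "S' = restrict S (verts Q)"
    have Su': "reduced_basis (d i) (U i) (S' i) (u i)" if "i \<in> verts Q" for i
      using Su that by (simp add: S'_def)
    have "euler_form Q (\<lambda>i. card (S' i)) (\<lambda>i. d i - card (S' i)) = euler_form Q e (\<lambda>i. d i - e i)"
      unfolding euler_form_def eS by (simp add: S'_def)
    then have "S' \<in> I"
      using neg Su' by (auto simp: I_def S'_def reduced_basis_def)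
    moreover have "P S' x = 0"
      by (rule P(3)[OF \<open>S' \<in> I\<close>]) (rule subrep_imp_in_chart_image[OF Q sub Su'])
    ultimately show False using x by blast
  qed
  then show ?thesis by (auto simp: Let_def)
qed

section \<open>Uniform expanders\<close>
lemma finite_eff_competitors:
  assumes "fin_digraph Q" "dimension_vector Q d"
  shows "finite (eff_competitors Q \<kappa> d \<delta>)"
proof -
  interpret fin_digraph Q by fact
  let ?g = "\<lambda>e i. if i \<in> verts Q then e i else (0 :: nat)"
  have "eff_competitors Q \<kappa> d \<delta> \<subseteq> ?g ` (\<Pi>\<^sub>E i\<in>verts Q. {..d i})"
  proof
    fix e assume "e \<in> eff_competitors Q \<kappa> d \<delta>"
    then have "e \<le> d" "dimension_vector Q e" by (auto simp: eff_competitors_def)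
    then have "e = ?g (restrict e (verts Q))" "restrict e (verts Q) \<in> (\<Pi>\<^sub>E i\<in>verts Q. {..d i})"
      by (auto simp: dimension_vector_def le_fun_def)
    then show "e \<in> ?g ` (\<Pi>\<^sub>E i\<in>verts Q. {..d i})" by blast
  qed
  then show ?thesis by (rule finite_subset) (auto intro!: finite_PiE)
qed

theorem lemma3p4:
  fixes Q :: "('v, 'a) pre_digraph"
    and \<theta> \<kappa> :: "'v \<Rightarrow> real"
    and d :: "nat \<Rightarrow> 'v \<Rightarrow> nat"
  assumes "fin_digraph Q"
    and "acyclic_quiver Q"
    and "\<forall>i\<in>verts Q. \<kappa> i > 0"
    and "\<forall>k\<ge>1. dimension_vector Q (d k)"
    and "unbounded_dims Q d"
    and "\<forall>\<delta>::real. 0 < \<delta> \<and> \<delta> < 1 \<longrightarrow>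
           (\<exists>\<epsilon>::real. \<epsilon> > 0 \<and> (\<forall>k\<ge>1. eps_eff Q \<theta> \<kappa> (d k) \<delta> \<ge> ereal \<epsilon>))"
  shows "supports_uniform_expander TYPE('f::alg_closed_field) Q \<theta> \<kappa> d"
proof -
  have "\<forall>k. \<exists>x :: 'a \<times> nat \<times> nat \<Rightarrow> 'f. \<forall>U. is_subrep Q (matrix_rep Q (d k) x) U \<longrightarrow>
    (let e = rep_dim Q (restrict_rep (matrix_rep Q (d k) x) U)
     in euler_form Q e (\<lambda>i. d k i - e i) \<ge> 0)"
    using generic_subrep_euler_form_nonneg[OF infinite_alg_closed_field assms(1)] by blast
  from choice[OF this] obtain x :: "nat \<Rightarrow> 'a \<times> nat \<times> nat \<Rightarrow> 'f" where
    x: "\<And>k U e. is_subrep Q (matrix_rep Q (d k) (x k)) U \<Longrightarrow>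
      e = rep_dim Q (restrict_rep (matrix_rep Q (d k) (x k)) U) \<Longrightarrow>
      euler_form Q e (\<lambda>i. d k i - e i) \<ge> 0"
    by (auto simp: Let_def)
  define V where "V = (\<lambda>k. matrix_rep Q (d k) (x k))"
  have dimV: "rep_dim Q (V k) = d k" if "k \<ge> 1" for k
    unfolding V_def using rep_dim_matrix_rep assms(4) that by blast
  have "uniform_expander Q \<theta> \<kappa> V"
    unfolding uniform_expander_def
  proof (intro conjI allI impI)
    show "is_rep Q (V k)" for k unfolding V_def by (rule is_rep_matrix_rep)
    show "unbounded_dims Q (\<lambda>k. rep_dim Q (V k))"
      using assms(5) dimV unfolding unbounded_dims_def by metis
  next
    fix \<delta> :: real assume \<delta>: "0 < \<delta> \<and> \<delta> < 1"
    then obtain \<epsilon> :: real where \<epsilon>: "\<epsilon> > 0" "\<And>k. k \<ge> 1 \<Longrightarrow> eps_eff Q \<theta> \<kappa> (d k) \<delta> \<ge> ereal \<epsilon>"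
      using assms(6) by blast
    \<comment> \<open>An expander requires a strict inequality, but the minimum in \<open>eps_eff\<close> may be equal to
      \<open>\<epsilon>\<close>.\<close>
    have "expander Q \<theta> \<kappa> \<delta> (\<epsilon> / 2) (V k)" if k: "k \<ge> 1" for k
      unfolding expander_def
    proof (intro allI impI, elim conjE)
      fix U assume U: "nonzero_subrep Q (V k) U"
        and le: "functional Q \<kappa> (rep_dim Q (restrict_rep (V k) U)) \<le> \<delta> * functional Q \<kappa> (rep_dim Q (V k))"
      define e where "e = rep_dim Q (restrict_rep (V k) U)"
      have sub: "is_subrep Q (V k) U" using U by (simp add: nonzero_subrep_def)
      have "dimension_vector Q e" by (simp add: e_def rep_dim_def dimension_vector_def)
      moreover have "e \<noteq> (\<lambda>_. 0)"
        using rep_dim_nonzero_subrep U unfolding e_def V_def by blast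
      moreover have "e \<le> d k"
        using rep_dim_subrep_le sub unfolding e_def V_def by blast
      moreover have "euler_form Q e (\<lambda>i. d k i - e i) \<ge> 0"
        using x sub unfolding e_def V_def by blast
      ultimately have e: "e \<in> eff_competitors Q \<kappa> (d k) \<delta>"
        using le dimV[OF k] by (simp add: eff_competitors_def e_def)
      let ?gaps = "(\<lambda>e. slope Q \<theta> \<kappa> (d k) - slope Q \<theta> \<kappa> e) ` eff_competitors Q \<kappa> (d k) \<delta>"
      have "\<epsilon> \<le> Min ?gaps"
        using \<epsilon>(2)[OF k] e by (auto simp: eps_eff_def split: if_splits)
      also have "\<dots> \<le> slope Q \<theta> \<kappa> (d k) - slope Q \<theta> \<kappa> e"
        using finite_eff_competitors[OF assms(1), of "d k" \<kappa> \<delta>] assms(4) k e by (intro Min_le) auto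
      finally show "slope Q \<theta> \<kappa> (rep_dim Q (restrict_rep (V k) U)) < slope Q \<theta> \<kappa> (rep_dim Q (V k)) - \<epsilon> / 2"
        using \<epsilon>(1) dimV[OF k] by (simp add: e_def)
    qed
    then show "\<exists>\<epsilon>>0. \<forall>k\<ge>1. expander Q \<theta> \<kappa> \<delta> \<epsilon> (V k)"
      using \<epsilon>(1) by (intro exI[of _ "\<epsilon> / 2"]) auto
  qed
  then show ?thesis
    unfolding supports_uniform_expander_def using dimV by blast
qed

end
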